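(* Let $1\le\alpha<2$. In general, the Adaptive Exploration Algorithm does not achieve a competitive ratio better than $\alpha$ on GEEWE instances in which every edge is announced with the interval $[1,\alpha]$: for every $c<\alpha$ there exists such an instance on which the cost of the Adaptive Exploration Algorithm exceeds $c\cdot\mathrm{OPT}$.
   Context: Graph Exploration with Edge Weight Estimates (GEEWE): An instance consists of a connected graph $G=(V,E)$, for every edge $e$ a lower bound $\ell(e)$ and an upper bound $u(e)$, a start vertex $s$ and a distinct end vertex $t$, and actual weights $w(e)\in[\ell(e),u(e)]$. The graph and bounds are known in advance; $w(e)$ is revealed as soon as the agent visits a vertex incident to $e$. The agent, starting at $s$, must perform a walk (repetitions allowed) from $s$ to $t$ visiting all vertices; its cost is the sum of actual weights of traversed edges with multiplicity; $\mathrm{OPT}$ is the minimum such cost when all actual weights are known. Adaptive Exploration Algorithm: while not all vertices have been visited, the agent computes a shortest walk from its current vertex to $t$ visiting all unvisited vertices, using actual weights for revealed edges and upper bounds $u(e)$ for unrevealed edges, and moves to the next vertex on that walk. *)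

theory Defs
  imports Complex_Main
begin

text \<open>Graphs are finite, simple and undirected; an edge is the set of its two end points.\<close>

record 'v geewe =
  verts :: "'v set"
  edges :: "'v set set"
  lower :: "'v set \<Rightarrow> real"
  upper :: "'v set \<Rightarrow> real"
  weight :: "'v set \<Rightarrow> real"
  source :: 'v
  target :: 'v

definition walk_betw :: "'v geewe \<Rightarrow> 'v \<Rightarrow> 'v list \<Rightarrow> 'v \<Rightarrow> bool" where
  "walk_betw I x W y \<longleftrightarrow>
     W \<noteq> [] \<and> hd W = x \<and> last W = y \<and> set W \<subseteq> verts I \<and>
     successively (\<lambda>a b. {a, b} \<in> edges I) W"

definition geewe_instance :: "'v geewe \<Rightarrow> bool" where
  "geewe_instance I \<longleftrightarrow>
     finite (verts I) \<and>
     (\<forall>e\<in>edges I. e \<subseteq> verts I \<and> card e = 2) \<and>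
     (\<forall>x\<in>verts I. \<forall>y\<in>verts I. \<exists>W. walk_betw I x W y) \<and>
     source I \<in> verts I \<and> target I \<in> verts I \<and> source I \<noteq> target I \<and>
     (\<forall>e\<in>edges I. lower I e \<le> weight I e \<and> weight I e \<le> upper I e)"

definition walk_cost :: "('v set \<Rightarrow> real) \<Rightarrow> 'v list \<Rightarrow> real" where
  "walk_cost f W = (\<Sum>i<length W - 1. f {W ! i, W ! Suc i})"

definition tour :: "'v geewe \<Rightarrow> 'v list \<Rightarrow> bool" where
  "tour I W \<longleftrightarrow> walk_betw I (source I) W (target I) \<and> verts I \<subseteq> set W"

text \<open>For positive edge weights the infimum is attained, see \<open>OPT_attained\<close> below.\<close>

definition OPT :: "'v geewe \<Rightarrow> real" where
  "OPT I = Inf {walk_cost (weight I) W | W. tour I W}"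

text \<open>The weight of an edge is revealed iff one of its end points lies in the set \<open>S\<close>
  of visited vertices.\<close>

definition estimate :: "'v geewe \<Rightarrow> 'v set \<Rightarrow> 'v set \<Rightarrow> real" where
  "estimate I S e = (if e \<inter> S \<noteq> {} then weight I e else upper I e)"

definition shortest_plan :: "'v geewe \<Rightarrow> 'v set \<Rightarrow> 'v \<Rightarrow> 'v list \<Rightarrow> bool" where
  "shortest_plan I S v W \<longleftrightarrow>
     is_arg_min (walk_cost (estimate I S))
       (\<lambda>W. walk_betw I v W (target I) \<and> verts I - S \<subseteq> set W) W"

text \<open>The list is the sequence of vertices visited so far. The relation leaves open which of
  several shortest plans is chosen, so that it covers every way of breaking ties.\<close>

inductive explores :: "'v geewe \<Rightarrow> 'v list \<Rightarrow> bool" for I where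
  start: "explores I [source I]"
| move: "explores I xs \<Longrightarrow> \<not> verts I \<subseteq> set xs \<Longrightarrow> shortest_plan I (set xs) (last xs) W
    \<Longrightarrow> explores I (xs @ [W ! 1])"

text \<open>The last new vertex need not be the target. In that case the agent follows the rest of its
  plan, which is now a shortest walk to the target with all weights revealed.\<close>

definition adaptive_walk :: "'v geewe \<Rightarrow> 'v list \<Rightarrow> bool" where
  "adaptive_walk I W \<longleftrightarrow>
     (\<exists>xs P. explores I xs \<and> verts I \<subseteq> set xs \<and>
       shortest_plan I (set xs) (last xs) P \<and> W = xs @ tl P)"

lemma OPT_attained:
  assumes I: "geewe_instance I" and pos: "\<And>e. e \<in> edges I \<Longrightarrow> 0 < lower I e"
    and ex: "tour I W0"
  shows "\<exists>W. tour I W \<and> walk_cost (weight I) W = OPT I"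
proof -
  let ?c = "walk_cost (weight I)"
  have wpos: "weight I e > 0" if "e \<in> edges I" for e
    using I pos[OF that] that by (force simp: geewe_instance_def)
  have "finite (edges I)"
    using I by (auto simp: geewe_instance_def intro: finite_subset[of _ "Pow (verts I)"])
  then obtain d where d: "d > 0" "\<And>e. e \<in> edges I \<Longrightarrow> d \<le> weight I e"
  proof (cases "edges I = {}")
    case False
    with \<open>finite (edges I)\<close> wpos show ?thesis
      by (intro that[of "Min (weight I ` edges I)"]) auto
  qed (use that[of 1] in auto)
  have low: "?c W \<ge> d * real (length W - 1)" if "tour I W" for W
  proof -
    have "successively (\<lambda>a b. {a, b} \<in> edges I) W"
      using that by (simp add: tour_def walk_betw_def)
    then have "{W ! i, W ! Suc i} \<in> edges I" if "i < length W - 1" for i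
      using that by (auto simp: successively_conv_nth)
    then have "(\<Sum>i<length W - 1. d) \<le> ?c W"
      unfolding walk_cost_def by (intro sum_mono d) auto
    then show ?thesis by (simp add: mult.commute)
  qed
  obtain n :: nat where n: "?c W0 / d \<le> real n" using real_arch_simple by blast
  let ?T = "{W. tour I W \<and> ?c W \<le> ?c W0}"
  have "length W \<le> Suc n" if "W \<in> ?T" for W
  proof -
    have "?c W0 \<le> d * real n" using n d(1) by (simp add: field_simps)
    then have "d * real (length W - 1) \<le> d * real n"
      using low[of W] that by auto
    then show ?thesis using d(1) by simp
  qed
  then have "?T \<subseteq> {W. set W \<subseteq> verts I \<and> length W \<le> Suc n}"
    by (auto simp: tour_def walk_betw_def)
  moreover have "finite (verts I)" using I by (simp add: geewe_instance_def)
  ultimately have fin: "finite ?T"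
    using finite_lists_length_le finite_subset by blast
  moreover have "W0 \<in> ?T" using ex by simp
  ultimately have "Min (?c ` ?T) \<in> ?c ` ?T" by (intro Min_in) auto
  then obtain M where M: "M \<in> ?T" "?c M = Min (?c ` ?T)" by auto
  have "?c M \<le> ?c W" if "tour I W" for W
  proof (cases "?c W \<le> ?c W0")
    case True
    then show ?thesis using that fin M(2) by auto
  next
    case False
    then show ?thesis using M(1) by simp
  qed
  then have "OPT I = ?c M"
    unfolding OPT_def using M(1) by (intro cInf_eq_minimum) auto
  then show ?thesis using M(1) by auto
qed

lemma shortest_planD:
  assumes "shortest_plan I S v P"
  shows "walk_betw I v P (target I)" "verts I - S \<subseteq> set P"
  using assms by (auto simp: shortest_plan_def is_arg_min_def)

lemma explores_walk:
  assumes "explores I xs" and I: "geewe_instance I"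
  shows "walk_betw I (source I) xs (last xs)"
  using assms(1)
proof induction
  case start
  then show ?case using I by (simp add: walk_betw_def geewe_instance_def)
next
  case (move xs W)
  note W = shortest_planD[OF move.hyps(3)]
  obtain y where y: "y \<in> verts I" "y \<notin> set xs" using move.hyps(2) by auto
  have ne: "xs \<noteq> []" using move.IH by (simp add: walk_betw_def)
  have "y \<in> set W" "y \<noteq> last xs" using y W(2) ne by auto
  then obtain b Ws where Wb: "W = last xs # b # Ws"
    using W(1) by (cases W; cases "tl W") (auto simp: walk_betw_def)
  then show ?case using move.IH W(1)
    by (auto simp: walk_betw_def successively_append_iff)
qed

lemma adaptive_walk_tour:
  assumes "adaptive_walk I W" and I: "geewe_instance I"
  shows "tour I W"
proof -
  from assms(1) obtain xs P where xs: "explores I xs" "verts I \<subseteq> set xs"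
    and P: "shortest_plan I (set xs) (last xs) P" and W: "W = xs @ tl P"
    by (auto simp: adaptive_walk_def)
  note wx = explores_walk[OF xs(1) I] and wP = shortest_planD(1)[OF P]
  obtain Q where Q: "P = last xs # Q"
    using wP by (cases P) (auto simp: walk_betw_def)
  show ?thesis
    using wx wP xs(2) unfolding W Q
    by (cases Q) (auto simp: tour_def walk_betw_def successively_append_iff)
qed

end

theory Submission
  imports Defs
begin

text \<open>Arrange the vertices on a path \<open>0, 1, \<dots>, 2 n\<close> of edges of weight \<open>\<alpha>\<close>, and join the lower
  half to the upper half by a zigzag \<open>n, n + 1, n - 1, n + 2, \<dots>, 1, 2 n\<close> of edges of weight 1.
  The edge \<open>{0, n}\<close> of weight \<open>\<alpha>\<close> lets the optimum enter the zigzag at its far end, so the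
  optimum is about \<open>2 n\<close>. The edge \<open>{0, 1}\<close> of weight 1 lures the agent onto the path instead.
  From then on, taking a zigzag edge saves only \<open>\<alpha> - 1 < 1\<close>, while it visits a vertex that
  has to be passed again later: the unvisited vertices above it are cut off from those below.
  In the upper half, reaching a vertex by a zigzag edge costs 2 in total, as one first has to go
  back to the visited lower half. So the agent walks along the whole path.\<close>

section \<open>Lower bounds for walk costs in general graphs\<close>

lemma walk_cost_singleton [simp]: "walk_cost f [x] = 0"
  by (simp add: walk_cost_def)

lemma walk_cost_Cons [simp]: "walk_cost f (x # y # zs) = f {x, y} + walk_cost f (y # zs)"
  by (simp add: walk_cost_def sum.lessThan_Suc_shift del: sum.lessThan_Suc)

lemma walk_cost_pos:
  assumes "1 < length W" "\<And>e. 1 \<le> f e"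
  shows "0 < walk_cost f W"
proof -
  have "0 < f e" for e using assms(2)[of e] by linarith
  then show ?thesis
    unfolding walk_cost_def using assms(1) by (intro sum_pos) (auto simp: lessThan_empty_iff)
qed

lemma card_weight_remove:
  fixes a :: real
  assumes "finite R"
  shows "a * card R = a * card (R - {w}) + (if w \<in> R then a else 0)"
proof (cases "w \<in> R")
  case True
  then have "card R = Suc (card (R - {w}))" using assms card_Suc_Diff1 by metis
  with True show ?thesis by (simp add: algebra_simps)
qed simp

text \<open>\<open>X\<close> contains the visited vertices with cheap edges to new vertices. Each departure from \<open>X\<close> saves
  at most \<open>a - 1\<close>, which the step that returned to \<open>X\<close> has already paid for, except at the start.\<close>

lemma cost_ge_credit:
  fixes f :: "'v set \<Rightarrow> real" and a :: real
  assumes a: "1 \<le> a" "a \<le> 2"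
    and ge1: "\<And>x y. {x, y} \<in> E \<Longrightarrow> 1 \<le> f {x, y}"
    and gea: "\<And>x y. {x, y} \<in> E \<Longrightarrow> x \<notin> X \<Longrightarrow> y \<notin> X \<Longrightarrow> a \<le> f {x, y}"
    and "successively (\<lambda>x y. {x, y} \<in> E) (v # W)"
    and "finite R" "R \<inter> X = {}" "v \<notin> R" "R \<subseteq> set W"
  shows "a * card R - (if v \<in> X then a - 1 else 0) \<le> walk_cost f (v # W)"
  using assms(5-)
proof (induction W arbitrary: v R)
  case Nil
  then show ?case using a by simp
next
  case (Cons w W)
  have e: "{v, w} \<in> E" using Cons.prems by simp
  have "a * card (R - {w}) - (if w \<in> X then a - 1 else 0) \<le> walk_cost f (w # W)"
    using Cons.prems by (intro Cons.IH) auto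
  moreover have "w \<in> R \<Longrightarrow> w \<notin> X" using Cons.prems by auto
  ultimately show ?case
    using ge1[OF e] gea[OF e] a
    unfolding card_weight_remove[OF \<open>finite R\<close>, of a w] walk_cost_Cons
    by (cases "v \<in> X"; cases "w \<in> X"; cases "w \<in> R")
      (simp_all only: if_True if_False simp_thms, linarith+)
qed

text \<open>A walk confined to \<open>H\<close>, or one still owing a visit to \<open>C \<subseteq> H\<close>, can only finish at
  \<open>t\<close> by leaving \<open>H\<close>, either through the already visited vertex \<open>p\<close> or through \<open>X\<close>; this
  outweighs what is gained from cheap edges.\<close>

lemma cost_ge_trapped:
  fixes f :: "'v set \<Rightarrow> real" and a :: real
  assumes a: "1 \<le> a" "a \<le> 2"
    and ge1: "\<And>x y. {x, y} \<in> E \<Longrightarrow> 1 \<le> f {x, y}"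
    and gea: "\<And>x y. {x, y} \<in> E \<Longrightarrow> x \<notin> X \<Longrightarrow> y \<notin> X \<Longrightarrow> a \<le> f {x, y}"
    and exit: "\<And>x y. {x, y} \<in> E \<Longrightarrow> x \<in> H \<Longrightarrow> y \<notin> H \<Longrightarrow>
                 y = p \<or> y \<in> X \<and> (x \<in> X \<or> a \<le> f {x, y})"
    and H: "C \<subseteq> H" "t \<notin> H" "p \<notin> X"
    and "successively (\<lambda>x y. {x, y} \<in> E) (v # W)" "last (v # W) = t"
    and "finite R" "R \<inter> X = {}" "v \<notin> R" "R \<subseteq> set W"
    and "p \<notin> R" "v \<in> H \<or> R \<inter> C \<noteq> {}"
  shows "a * card R + (if v \<in> X then 0 else 1) \<le> walk_cost f (v # W)"
  using assms(9-)
proof (induction W arbitrary: v R)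
  case Nil
  then show ?case using H by auto
next
  case (Cons w W)
  have e: "{v, w} \<in> E" using Cons.prems by simp
  have wX: "w \<in> R \<Longrightarrow> w \<notin> X" using Cons.prems by auto
  note rem = card_weight_remove[OF \<open>finite R\<close>, of a w]
  show ?case
  proof (cases "w \<in> H \<or> (R - {w}) \<inter> C \<noteq> {}")
    case True
    have "a * card (R - {w}) + (if w \<in> X then 0 else 1) \<le> walk_cost f (w # W)"
      using Cons.prems True by (intro Cons.IH) auto
    then show ?thesis using wX ge1[OF e] gea[OF e] a unfolding rem walk_cost_Cons
      by (cases "v \<in> X"; cases "w \<in> X"; cases "w \<in> R")
        (simp_all only: if_True if_False simp_thms, linarith+)
  next
    case False
    \<comment> \<open>A step to \<open>w\<close> outside \<open>H\<close> cannot discharge a visit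
      owed to \<open>C\<close>, so with nothing owed any more \<open>v\<close> must lie in
      \<open>H\<close>. An exit to \<open>p\<close> pays at least 1 for no new vertex. An exit to
      \<open>X\<close> starts in \<open>X\<close> or costs \<open>a\<close>; as
      \<open>a \<le> 2\<close>, this covers the credit \<open>a - 1\<close>.\<close>
    then have "v \<in> H" "w \<notin> H" using Cons.prems H by auto
    note ex = exit[OF e this]
    then have "w \<notin> R" using wX Cons.prems by auto
    have "a * card (R - {w}) - (if w \<in> X then a - 1 else 0) \<le> walk_cost f (w # W)"
      using Cons.prems by (intro cost_ge_credit[of a E f X]) (auto simp: a ge1 gea)
    moreover have "w \<in> X \<Longrightarrow> v \<in> X \<or> a \<le> f {v, w}" using ex H by auto
    ultimately show ?thesis using \<open>w \<notin> R\<close> ge1[OF e] gea[OF e] a unfolding rem walk_cost_Cons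
      by (cases "v \<in> X"; cases "w \<in> X")
        (simp_all only: if_True if_False simp_thms, linarith+)
  qed
qed

section \<open>The zigzag instances\<close>

text \<open>Sums of neighbours on the zigzag alternate between \<open>2 * n + 1\<close> and
  \<open>2 * n\<close>. Positivity keeps out the pair \<open>{0, 2 * n}\<close>, which has such a
  sum but would join source and target directly.\<close>

definition link :: "nat \<Rightarrow> nat \<Rightarrow> nat \<Rightarrow> bool" where
  "link n x y \<longleftrightarrow> x \<noteq> y \<and> x \<le> 2 * n \<and> y \<le> 2 * n \<and>
     (y = Suc x \<or> x = Suc y \<or> x = 0 \<and> y = n \<or> x = n \<and> y = 0 \<or>
      0 < x \<and> 0 < y \<and> (x + y = 2 * n \<or> x + y = 2 * n + 1))"

text \<open>The sums of the end points single out the cheap edges: \<open>{0, 1}\<close> has sum 1, the zigzag edges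
  have sum \<open>2 n\<close> or \<open>2 n + 1\<close>. The edge \<open>{n, n + 1}\<close> lies on both the path and the zigzag.\<close>

definition zigzag_instance :: "nat \<Rightarrow> real \<Rightarrow> nat geewe" where
  "zigzag_instance n a =
     \<lparr>verts = {..2 * n}, edges = {{x, y} | x y. link n x y}, lower = (\<lambda>_. 1), upper = (\<lambda>_. a),
      weight = (\<lambda>e. if \<Sum>e \<in> {1, 2 * n, 2 * n + 1} then 1 else a),
      source = 0, target = 2 * n\<rparr>"

text \<open>The last stretch of the zigzag, from \<open>k > 0\<close> to \<open>2 * n\<close>;
  \<open>k = n\<close> gives all of it.\<close>

fun zigzag_walk :: "nat \<Rightarrow> nat \<Rightarrow> nat list" where
  "zigzag_walk n 0 = []"
| "zigzag_walk n (Suc k) = Suc k # (2 * n - k) # zigzag_walk n k"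

locale zigzag =
  fixes n :: nat and a :: real
  assumes n: "2 \<le> n" and a: "1 \<le> a" "a < 2"
begin

abbreviation "I \<equiv> zigzag_instance n a"
abbreviation "est k \<equiv> estimate I {..k}"

lemma I_simps [simp]: "verts I = {..2 * n}" "lower I e = 1" "upper I e = a" "source I = 0"
  "target I = 2 * n"
  by (simp_all add: zigzag_instance_def)

lemma edge_iff [simp]: "{x, y} \<in> edges I \<longleftrightarrow> link n x y"
  by (auto simp: zigzag_instance_def doubleton_eq_iff link_def)

lemma weight_pair:
  "x \<noteq> y \<Longrightarrow> weight I {x, y} = (if x + y \<in> {1, 2 * n, 2 * n + 1} then 1 else a)"
  by (simp add: zigzag_instance_def)

lemma weight_ge: "1 \<le> weight I e" and weight_le: "weight I e \<le> a"
  using a by (auto simp: zigzag_instance_def)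

lemma est_pair:
  "x \<noteq> y \<Longrightarrow> est k {x, y} =
     (if (x \<le> k \<or> y \<le> k) \<and> x + y \<in> {1, 2 * n, 2 * n + 1} then 1 else a)"
  by (auto simp: estimate_def weight_pair)

lemma est_ge: "1 \<le> est k e"
  using a weight_ge by (simp add: estimate_def)

lemma successively_link_upt: "j \<le> Suc (2 * n) \<Longrightarrow> successively (link n) [i..<j]"
  by (auto simp: successively_conv_nth link_def)

lemma walk_upt: "i \<le> j \<Longrightarrow> j \<le> 2 * n \<Longrightarrow> walk_betw I i [i..<Suc j] j"
  using successively_link_upt[of "Suc j" i] by (auto simp: walk_betw_def simp del: upt_Suc)

lemma link_sym: "link n x y \<longleftrightarrow> link n y x"
  by (auto simp: link_def)

lemma walk_rev: "walk_betw I x W y \<Longrightarrow> walk_betw I y (rev W) x"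
  by (auto simp: walk_betw_def hd_rev last_rev link_sym)

lemma instance_I: "geewe_instance I"
proof -
  have "e \<subseteq> verts I \<and> card e = 2" if "e \<in> edges I" for e
    using that by (auto simp: zigzag_instance_def link_def)
  moreover have "\<exists>W. walk_betw I x W y" if "x \<in> verts I" "y \<in> verts I" for x y
    using that walk_upt[of x y] walk_rev[OF walk_upt[of y x]] by (cases "x \<le> y") auto
  ultimately show ?thesis
    unfolding geewe_instance_def using n weight_ge weight_le by auto
qed

section \<open>The agent's shortest plans\<close>

text \<open>Estimated cost of staying on the path once \<open>0, ..., k\<close> are visited: of the
  edges ahead only \<open>{k, Suc k}\<close> is revealed, and it is cheap exactly for
  \<open>k = 0\<close> and \<open>k = n\<close>.\<close>

definition planned :: "nat \<Rightarrow> real" where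
  "planned k = a * real (2 * n - k) - (if k = 0 \<or> k = n then a - 1 else 0)"

lemma est_step: "est k {k, Suc k} = (if k = 0 \<or> k = n then 1 else a)"
  using n by (auto simp: est_pair)

lemma est_path: "k < j \<Longrightarrow> est k {j, Suc j} = a"
  by (simp add: est_pair)

lemma walk_cost_upt:
  assumes "i < m"
  shows "walk_cost f [i..<Suc m] = f {i, Suc i} + walk_cost f [Suc i..<Suc m]"
proof -
  have "[i..<Suc m] = i # [Suc i..<Suc m]" "[Suc i..<Suc m] = Suc i # [Suc (Suc i)..<Suc m]"
    using assms by (intro upt_conv_Cons; simp)+
  then show ?thesis using walk_cost_Cons by metis
qed

lemma cost_upt_after:
  "k < j \<Longrightarrow> j \<le> 2 * n \<Longrightarrow> walk_cost (est k) [j..<Suc (2 * n)] = a * real (2 * n - j)"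
proof (induction "2 * n - j" arbitrary: j)
  case 0
  then show ?case by simp
next
  case (Suc d)
  have "walk_cost (est k) [Suc j..<Suc (2 * n)] = a * real (2 * n - Suc j)"
    using Suc by (intro Suc.hyps) auto
  moreover have "real (2 * n - j) = real (2 * n - Suc j) + 1" using Suc by simp
  moreover have "j < 2 * n" using Suc by simp
  ultimately show ?case using est_path[OF Suc.prems(1)]
    by (simp only: walk_cost_upt distrib_left mult_1_right add.commute)
qed

lemma cost_upt:
  assumes "k < 2 * n"
  shows "walk_cost (est k) [k..<Suc (2 * n)] = planned k"
proof -
  have "real (2 * n - k) = real (2 * n - Suc k) + 1" using assms by simp
  then show ?thesis
    unfolding walk_cost_upt[OF assms] planned_def est_step
    using cost_upt_after[of k "Suc k"] assms by (simp add: algebra_simps del: upt_Suc)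
qed

text \<open>A first step other than to \<open>Suc k\<close> visits nothing new, takes the edge
  \<open>{0, n}\<close> at price \<open>a\<close>, or jumps up the zigzag and traps the walk. For
  \<open>k = 0\<close> and \<open>a = 1\<close> the edges \<open>{0, 1}\<close> and
  \<open>{0, n}\<close> tie, hence the side condition for strictness.\<close>

lemma plan_cost:
  assumes k: "k < 2 * n" and W: "walk_betw I k W (2 * n)" "{..2 * n} - {..k} \<subseteq> set W"
  shows "planned k \<le> walk_cost (est k) W"
    and "k > 0 \<or> a > 1 \<Longrightarrow> W ! 1 \<noteq> Suc k \<Longrightarrow> planned k < walk_cost (est k) W"
proof -
  \<comment> \<open>Visited vertices above \<open>n\<close> are left out: two vertices above
    \<open>n\<close> have sum beyond \<open>2 * n + 1\<close>, so an edge between them is never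
    cheap.\<close>
  define X where "X = {..min k n}"
  let ?E = "edges I" and ?R = "{k<..2 * n}"
  obtain w V where Wk: "W = k # w # V"
    using W(1) k by (cases W; cases "tl W") (auto simp: walk_betw_def)
  have sub: "?R \<subseteq> insert w (set V)" using W(2) k unfolding Wk by auto
  have kw: "link n k w" and suc: "successively (\<lambda>x y. {x, y} \<in> ?E) (w # V)"
    and lst: "last (w # V) = 2 * n"
    using W(1) unfolding Wk by (auto simp: walk_betw_def)
  have gea: "a \<le> est k {x, y}" if "{x, y} \<in> ?E" "x \<notin> X" "y \<notin> X" for x y
    using that by (auto simp: est_pair X_def link_def)
  define r where "r = a * real (card (?R - {w}))"
  have rest: "r - (if w \<in> X then a - 1 else 0) \<le> walk_cost (est k) (w # V)"
    unfolding r_def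
    using a suc sub by (intro cost_ge_credit[of a ?E _ X] est_ge gea) (auto simp: X_def)
  have rem: "a * real (2 * n - k) = r + (if w \<in> ?R then a else 0)"
    unfolding r_def using card_weight_remove[of ?R a w]
    by (simp only: finite_greaterThanAtMost card_greaterThanAtMost)
  have cost: "walk_cost (est k) W = est k {k, w} + walk_cost (est k) (w # V)"
    by (simp add: Wk)
  have pl: "planned k \<le> a * real (2 * n - k)" using a by (simp add: planned_def)
  consider (forward) "w = Suc k" | (return) "w \<in> X" "w \<noteq> Suc k" | (start) "k = 0" "w = n"
    | (up) "n < k" "w \<notin> X" "w \<noteq> Suc k" | (jump) "0 < k" "k < n" 
        "k + w = 2 * n \<or> k + w = 2 * n + 1"
    using kw n unfolding X_def link_def by (cases "k = 0"; cases "k < n"; cases "k = n") auto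
  then have "planned k \<le> walk_cost (est k) W \<and>
    ((k > 0 \<or> a > 1) \<and> w \<noteq> Suc k \<longrightarrow> planned k < walk_cost (est k) W)"
  proof cases
    case forward
    then have "w \<notin> X" by (auto simp: X_def)
    then show ?thesis using rest rem cost est_step[of k, folded forward] forward k
      by (auto simp: planned_def)
  next
    case return
    then have "w \<notin> ?R" by (auto simp: X_def)
    then show ?thesis using rest rem cost est_ge[of k "{k, w}"] return pl a by auto
  next
    case start
    then have "est k {k, w} = a" using n est_pair[of k w k] by auto
    moreover have "w \<notin> X" using start n by (auto simp: X_def)
    ultimately show ?thesis using rest rem cost start n a by (auto simp: planned_def)
  next
    \<comment> \<open>Zigzag edges from \<open>k > n\<close> lead into \<open>X\<close>, so this is
      a step back along the upper half.\<close>
    case up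
    then have "w \<notin> ?R" using kw by (auto simp: link_def)
    moreover have "a \<le> est k {k, w}" using up kw
      by (auto simp: est_pair X_def link_def)
    ultimately show ?thesis using rest rem cost up pl a by auto
  next
    case jump
    have "w \<noteq> Suc k" using jump by presburger
    then have "Suc k \<in> (?R - {w}) \<inter> {Suc k..n}" using jump by auto
    then have owed: "(?R - {w}) \<inter> {Suc k..n} \<noteq> {}" by blast
    \<comment> \<open>The jump costs at least 1 and being trapped adds 1 more. Together this exceeds
      \<open>a\<close>, the gain from visiting \<open>w\<close>; here \<open>a < 2\<close> is
      decisive.\<close>
    have "r + (if w \<in> X then 0 else 1) \<le> walk_cost (est k) (w # V)"
      unfolding r_def
    proof (rule cost_ge_trapped[where E = ?E and X = X and H = "{2 * n + 1 - w..<w}" and p = w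
          and C = "{Suc k..n}" and t = "2 * n"])
      \<comment> \<open>\<open>H\<close> is symmetric about \<open>n\<close>, so zigzag edges of sum
        \<open>2 * n\<close> stay inside and one of sum \<open>2 * n + 1\<close> can leave only to
        \<open>w\<close>. The other exits, along the path or by \<open>{n, 0}\<close>, end in
        \<open>X\<close>.\<close>
      fix x y
      assume "{x, y} \<in> ?E" "x \<in> {2 * n + 1 - w..<w}" "y \<notin> {2 * n + 1 - w..<w}"
      then show "y = w \<or> y \<in> X \<and> (x \<in> X \<or> a \<le> est k {x, y})"
        using jump n by (auto simp: link_def X_def est_pair)
    qed (use a suc sub lst jump est_ge gea owed in \<open>auto simp: X_def\<close>)
    moreover have "w \<in> ?R" "w \<notin> X" using jump by (auto simp: X_def)
    ultimately show ?thesis using rem cost est_ge[of k "{k, w}"] pl a by auto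
  qed
  then show "planned k \<le> walk_cost (est k) W"
    and "k > 0 \<or> a > 1 \<Longrightarrow> W ! 1 \<noteq> Suc k \<Longrightarrow> planned k < walk_cost (est k) W"
    by (auto simp: Wk)
qed

lemma shortest_plan_upt:
  assumes "k < 2 * n"
  shows "shortest_plan I {..k} k [k..<Suc (2 * n)]"
  unfolding shortest_plan_def is_arg_min_def cost_upt[OF assms]
  using walk_upt[of k "2 * n"] plan_cost(1)[OF assms] assms
  by (auto simp: not_less simp del: upt_Suc)

lemma shortest_plan_step:
  assumes "k < 2 * n" "shortest_plan I {..k} k W" "k > 0 \<or> a > 1"
  shows "W ! 1 = Suc k"
proof -
  have "walk_cost (est k) W \<le> planned k"
    using assms(2) shortest_plan_upt[OF assms(1)] cost_upt[OF assms(1)]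
    unfolding shortest_plan_def is_arg_min_def by (metis not_less)
  then show ?thesis
    using plan_cost(2)[OF assms(1) shortest_planD[OF assms(2), simplified] assms(3)] by auto
qed

section \<open>The agent's runs\<close>

lemma set_upt_Suc: "set [0..<Suc k] = {..k}"
  by auto

lemma explores_upt: "k \<le> 2 * n \<Longrightarrow> explores I [0..<Suc k]"
proof (induction k)
  case 0
  then show ?case using explores.start[of I] by simp
next
  case (Suc k)
  have "explores I ([0..<Suc k] @ [[k..<Suc (2 * n)] ! 1])"
    using Suc shortest_plan_upt[of k] by (intro explores.move) (simp_all add: set_upt_Suc del: upt_Suc set_upt)
  then show ?case using Suc.prems by (simp del: upt_Suc) simp
qed

text \<open>For \<open>a > 1\<close> all shortest plans agree on the next vertex, so tie-breaking
  has no influence.\<close>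

lemma explores_unique:
  assumes "explores I xs" "a > 1"
  shows "\<exists>k\<le>2 * n. xs = [0..<Suc k]"
  using assms(1)
proof induction
  case start
  then show ?case by (intro exI[of _ 0]) simp
next
  case (move xs W)
  then obtain k where k: "k \<le> 2 * n" "xs = [0..<Suc k]" by blast
  then have "k < 2 * n" using move.hyps(2) unfolding k(2) set_upt_Suc by (cases "k = 2 * n") auto
  moreover have "shortest_plan I {..k} k W"
    using move.hyps(3) unfolding k(2) set_upt_Suc by simp
  ultimately have "W ! 1 = Suc k" using shortest_plan_step assms(2) by blast
  then show ?case using \<open>k < 2 * n\<close> k(2) by (intro exI[of _ "Suc k"]) simp
qed

text \<open>Estimates are at least 1, so any walk that moves costs more than staying at the
  target.\<close>

lemma shortest_plan_end: "shortest_plan I {..2 * n} (2 * n) P \<longleftrightarrow> P = [2 * n]"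
proof -
  let ?Q = "\<lambda>W. walk_betw I (2 * n) W (2 * n) \<and> verts I - {..2 * n} \<subseteq> set W"
  have pos: "W = [2 * n] \<or> 0 < walk_cost (est (2 * n)) W" if "?Q W" for W
  proof (cases "length W \<le> 1")
    case True
    then show ?thesis using that by (cases W) (auto simp: walk_betw_def)
  next
    case False
    then show ?thesis using est_ge by (intro disjI2 walk_cost_pos) auto
  qed
  have "?Q [2 * n]" by (simp add: walk_betw_def)
  then show ?thesis
    unfolding shortest_plan_def is_arg_min_def I_simps(5)
    using pos by (metis less_asym walk_cost_singleton)
qed

lemma adaptive_walk_upt: "adaptive_walk I [0..<Suc (2 * n)]"
proof -
  let ?xs = "[0..<Suc (2 * n)]"
  have "shortest_plan I (set ?xs) (last ?xs) [2 * n]"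
    unfolding set_upt_Suc using shortest_plan_end by simp
  moreover have "verts I \<subseteq> set ?xs" unfolding set_upt_Suc by simp
  moreover have "?xs = ?xs @ tl [2 * n]" by simp
  ultimately show ?thesis
    using explores_upt[of "2 * n"] unfolding adaptive_walk_def by blast
qed

lemma adaptive_walk_unique:
  assumes "adaptive_walk I W" "a > 1"
  shows "W = [0..<Suc (2 * n)]"
proof -
  from assms(1) obtain xs P where xs: "explores I xs" "verts I \<subseteq> set xs"
    and P: "shortest_plan I (set xs) (last xs) P" and W: "W = xs @ tl P"
    by (auto simp: adaptive_walk_def)
  obtain k where k: "k \<le> 2 * n" "xs = [0..<Suc k]" using explores_unique[OF xs(1) assms(2)] by blast
  then have "2 * n \<in> set [0..<Suc k]" using xs(2) by auto
  then have "k = 2 * n" using k(1) unfolding set_upt_Suc by simp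
  then have "P = [2 * n]" using P shortest_plan_end unfolding k(2) set_upt_Suc by simp
  then show ?thesis using W k(2) \<open>k = 2 * n\<close> by simp
qed

section \<open>The agent's cost and the optimum\<close>

lemma adaptive_cost: "walk_cost (weight I) [0..<Suc (2 * n)] = 2 * (real n - 1) * a + 2"
proof -
  have "walk_cost (weight I) [0..<Suc (2 * n)] = (\<Sum>i<2 * n. weight I {i, Suc i})"
    unfolding walk_cost_def by (intro sum.cong) (auto simp: nth_append simp del: upt_Suc)
  also have "\<dots> = (\<Sum>i<2 * n. a - (if i \<in> {0, n} then a - 1 else 0))"
  proof (intro sum.cong refl)
    fix i assume "i \<in> {..<2 * n}"
    \<comment> \<open>The sum is odd, which rules out \<open>2 * n\<close>.\<close>
    have "i + Suc i \<in> {1, 2 * n, 2 * n + 1} \<longleftrightarrow> i \<in> {0, n}" by auto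
    then show "weight I {i, Suc i} = a - (if i \<in> {0, n} then a - 1 else 0)"
      by (subst weight_pair) auto
  qed
  also have "\<dots> = 2 * n * a - (\<Sum>i<2 * n. if i \<in> {0, n} then a - 1 else 0)"
    by (simp only: sum_subtractf sum_constant card_lessThan of_nat_mult of_nat_numeral)
  also have "\<dots> = 2 * n * a - (\<Sum>i\<in>{..<2 * n} \<inter> {0, n}. a - 1)"
    by (simp only: sum.inter_restrict[OF finite_lessThan])
  also have "{..<2 * n} \<inter> {0, n} = {0, n}" using n by auto
  finally show ?thesis using n by (simp add: algebra_simps)
qed

text \<open>One joint induction, since attaching two vertices in front needs the head of the shorter
  walk. The two new edges have sums \<open>2 * n + 1\<close> and \<open>2 * n\<close>.\<close>

lemma zigzag_walk:
  assumes "k < n"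
  shows "zigzag_walk n (Suc k) \<noteq> [] \<and> hd (zigzag_walk n (Suc k)) = Suc k \<and>
    last (zigzag_walk n (Suc k)) = 2 * n \<and>
    set (zigzag_walk n (Suc k)) = {1..Suc k} \<union> {2 * n - k..2 * n} \<and>
    successively (link n) (zigzag_walk n (Suc k)) \<and>
    walk_cost (weight I) (zigzag_walk n (Suc k)) = 2 * real k + 1"
  using assms
proof (induction k)
  case 0
  then show ?case by (auto simp: link_def weight_pair)
next
  case (Suc k)
  obtain zs where zs: "zigzag_walk n (Suc k) = Suc k # zs" by simp
  have "weight I {Suc (Suc k), 2 * n - Suc k} = 1" "weight I {2 * n - Suc k, Suc k} = 1"
    using Suc.prems by (subst weight_pair; force)+
  moreover have "link n (Suc (Suc k)) (2 * n - Suc k)" "link n (2 * n - Suc k) (Suc k)"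
    using Suc.prems by (auto simp: link_def)
  moreover have "{1..Suc (Suc k)} \<union> {2 * n - Suc k..2 * n} =
      {Suc (Suc k), 2 * n - Suc k} \<union> ({1..Suc k} \<union> {2 * n - k..2 * n})"
    using Suc.prems by auto
  ultimately show ?case
    using Suc.IH Suc.prems unfolding zigzag_walk.simps(2)[of n "Suc k"] zs
    by (simp del: zigzag_walk.simps)
qed

lemma tour_cost_pos:
  assumes "tour I W"
  shows "0 < walk_cost (weight I) W"
proof -
  have "length W > 1" using assms n
    by (cases W; cases "tl W") (auto simp: tour_def walk_betw_def)
  then show ?thesis using weight_ge by (rule walk_cost_pos)
qed

lemma
  assumes "tour I W"
  shows OPT_pos: "0 < OPT I" and OPT_le_tour: "OPT I \<le> walk_cost (weight I) W"
proof -
  show "0 < OPT I"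
    using OPT_attained[OF instance_I _ assms] tour_cost_pos by force
  show "OPT I \<le> walk_cost (weight I) W"
    unfolding OPT_def using assms
    by (intro cInf_lower bdd_belowI[of _ 0]) (auto intro: less_imp_le tour_cost_pos)
qed

text \<open>The tour enters by \<open>{0, n}\<close> at cost \<open>a\<close> and then follows the
  \<open>2 * n - 1\<close> unit edges of the zigzag.\<close>

lemma OPT_le: "OPT I \<le> 2 * real n - 1 + a"
proof -
  let ?Z = "zigzag_walk n n"
  define k where "k = n - 1"
  have k: "n = Suc k" "k < n" using n by (simp_all add: k_def)
  have z: "?Z \<noteq> []" "hd ?Z = n" "last ?Z = 2 * n" "set ?Z = {1..n} \<union> {2 * n - k..2 * n}"
    "successively (link n) ?Z" "walk_cost (weight I) ?Z = 2 * real k + 1"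
    using zigzag_walk[OF k(2), folded k(1)] by blast+
  have "2 * n - k = Suc n" using k(1) by linarith
  then have "set ?Z = {1..n} \<union> {Suc n..2 * n}" using z(4) by (simp only:)
  also have "\<dots> = {1..2 * n}" by auto
  finally have set_Z: "set ?Z = {1..2 * n}" .
  have "real k = real n - 1" using k(1) by linarith
  then have cost_Z: "walk_cost (weight I) ?Z = 2 * real n - 1" using z(6) by linarith
  obtain zs where zs: "?Z = n # zs" using z(1,2) by (cases ?Z) auto
  have "link n 0 n" using n by (auto simp: link_def)
  then have "successively (link n) (0 # ?Z)" using z(5) unfolding zs by simp
  moreover have "set (0 # ?Z) = {..2 * n}" using set_Z by auto
  ultimately have "tour I (0 # ?Z)"
    using z(1,3) unfolding tour_def walk_betw_def by simp
  then have "OPT I \<le> walk_cost (weight I) (0 # ?Z)" by (rule OPT_le_tour)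
  also have "weight I {0, n} = a" using n by (subst weight_pair) auto
  then have "walk_cost (weight I) (0 # ?Z) = 2 * real n - 1 + a"
    using cost_Z unfolding zs walk_cost_Cons by simp
  finally show ?thesis .
qed

end

theorem theorem5:
  fixes \<alpha> c :: real
  assumes "1 \<le> \<alpha>" and "\<alpha> < 2" and "c < \<alpha>"
  shows "\<exists>I :: nat geewe. geewe_instance I \<and>
           (\<forall>e\<in>edges I. lower I e = 1 \<and> upper I e = \<alpha>) \<and>
           (\<exists>W. adaptive_walk I W) \<and>
           (\<forall>W. adaptive_walk I W \<longrightarrow> walk_cost (weight I) W > c * OPT I)"
proof -
  \<comment> \<open>Nonnegativity lets the upper bound on \<open>OPT I\<close> be multiplied by
    \<open>d\<close>.\<close>
  define d where "d = max c 0"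
  have d: "c \<le> d" "0 \<le> d" "d < \<alpha>" using assms by (auto simp: d_def)
  \<comment> \<open>The desired inequality amounts to
    \<open>2 * \<alpha> + d * \<alpha> < 2 * n * (\<alpha> - d) + d + 2\<close>.\<close>
  obtain m :: nat where m: "(2 * \<alpha> + d * \<alpha>) / (\<alpha> - d) \<le> m" using real_arch_simple by blast
  define n where "n = m + 2"
  interpret zigzag n \<alpha> using assms by unfold_locales (auto simp: n_def)
  have "2 * \<alpha> + d * \<alpha> \<le> m * (\<alpha> - d)" using m d by (simp add: field_simps)
  also have "\<dots> \<le> 2 * n * (\<alpha> - d)" using d by (intro mult_right_mono) (auto simp: n_def)
  finally have "d * (2 * real n - 1 + \<alpha>) < 2 * (real n - 1) * \<alpha> + 2"
    using d by (simp add: n_def algebra_simps)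
  with OPT_le d have big: "d * OPT I < 2 * (real n - 1) * \<alpha> + 2"
    by (meson le_less_trans mult_left_mono)
  have "c * OPT I < walk_cost (weight I) W" if W: "adaptive_walk I W" for W
  proof -
    note t = adaptive_walk_tour[OF W instance_I]
    show ?thesis
    proof (cases "\<alpha> > 1")
      case True
      have "c * OPT I \<le> d * OPT I" using d OPT_pos[OF t] by simp
      with big show ?thesis using adaptive_walk_unique[OF W True] adaptive_cost by simp
    next
      \<comment> \<open>Now \<open>\<alpha> = 1\<close> and ties may change the walk, but
        \<open>c < 1\<close> and every tour costs at least \<open>OPT I\<close>.\<close>
      case False
      then have "c * OPT I < 1 * OPT I" using assms OPT_pos[OF t] by (intro mult_strict_right_mono) auto
      then show ?thesis using OPT_le_tour[OF t] by simp
    qed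
  qed
  then show ?thesis using instance_I adaptive_walk_upt by (intro exI[of _ I]) auto
qed

end
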